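(* Let $\mathcal{X}\subseteq\mathbb{R}^m$ be a closed convex set, let $f:\mathcal{X}\to\mathbb{R}$ be continuous, and let $u:\mathcal{X}\times\mathcal{X}\to\mathbb{R}$ satisfy: (A1) $u(y,y)=f(y)$ for all $y\in\mathcal{X}$; (A2) $u(x,y)\ge f(x)$ for all $x,y\in\mathcal{X}$; (A3) $u'(x,y;d)\big|_{x=y}=f'(y;d)$ for all $y\in\mathcal{X}$ and all $d\in\mathbb{R}^m$ with $y+d\in\mathcal{X}$, where the directional derivative $u'(x,y;d)$ is taken with respect to the first variable $x$ only; (A4) $u(x,y)$ is continuous in $(x,y)$. Let $x^0\in\mathcal{X}$ and let $\{x^r\}_{r\ge 0}$ be any sequence generated by the SUM algorithm, i.e. $x^r\in\arg\min_{x\in\mathcal{X}}u(x,x^{r-1})$ for every $r\ge1$ (an arbitrary minimizer being chosen each time). Then every limit point of $\{x^r\}$ is a stationary point of the problem $\min_{x\in\mathcal{X}} f(x)$.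
   Context: Directional derivative: for a function $g$ on a convex set $\mathcal{D}$, $x\in\mathcal{D}$ and $d$ with $x+d\in\mathcal{D}$, $g'(x;d):=\liminf_{\lambda\downarrow0}\frac{g(x+\lambda d)-g(x)}{\lambda}$. A point $x\in\mathcal{X}$ is a stationary point of $\min_{\mathcal{X}}f$ if $f'(x;d)\ge0$ for all $d$ with $x+d\in\mathcal{X}$. A limit point of a sequence is the limit of some convergent subsequence. *)

theory Defs
  imports "HOL-Analysis.Analysis"
begin

text \<open>The lower limit is taken in the extended reals, so \<open>\<plusminus>\<infinity>\<close> are possible values.
  If \<open>x\<close> and \<open>x + d\<close> lie in a convex set, so does \<open>x + t *\<^sub>R d\<close> for \<open>0 < t < 1\<close>;
  hence only values of \<open>g\<close> on that set matter.\<close>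

definition dir_deriv :: "('a::real_vector \<Rightarrow> real) \<Rightarrow> 'a \<Rightarrow> 'a \<Rightarrow> ereal" where
  "dir_deriv g x d = Liminf (at_right (0::real)) (\<lambda>t. ereal ((g (x + t *\<^sub>R d) - g x) / t))"

definition stationary_point :: "('a::real_vector \<Rightarrow> real) \<Rightarrow> 'a set \<Rightarrow> 'a \<Rightarrow> bool" where
  "stationary_point f X x \<longleftrightarrow> x \<in> X \<and> (\<forall>d. x + d \<in> X \<longrightarrow> dir_deriv f x d \<ge> 0)"

definition seq_limit_point :: "(nat \<Rightarrow> 'a::topological_space) \<Rightarrow> 'a \<Rightarrow> bool" where
  "seq_limit_point s z \<longleftrightarrow> (\<exists>r :: nat \<Rightarrow> nat. strict_mono r \<and> (s \<circ> r) \<longlonglongrightarrow> z)"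

definition SUM_sequence :: "('a \<Rightarrow> 'a \<Rightarrow> real) \<Rightarrow> 'a set \<Rightarrow> (nat \<Rightarrow> 'a) \<Rightarrow> bool" where
  "SUM_sequence u X s \<longleftrightarrow>
     s 0 \<in> X \<and> (\<forall>r\<ge>1. is_arg_min (\<lambda>x. u x (s (r - 1))) (\<lambda>x. x \<in> X) (s r))"

end

theory Submission
  imports Defs
begin

text \<open>Since f (s (n + 1)) \<le> u (s (n + 1)) (s n) \<le> u x (s n) for every feasible x, the values f (s n)
  decrease, and along a subsequence r with limit z this gives f (s (r (k + 1))) \<le> u x (s (r k)).
  Letting k tend to infinity, u z z = f z \<le> u x z: the limit point minimizes its own majorizer,
  so it is stationary for that majorizer and hence, by equality of directional derivatives, for f.\<close>

text \<open>For \<open>0 < t < 1\<close> the point \<open>y + t *\<^sub>R d\<close> is a convex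
  combination of \<open>y\<close> and \<open>y + d\<close>, so it stays in \<open>X\<close>, where
  \<open>g y\<close> is minimal. The difference quotients are thus nonnegative near 0 from the
  right, and the bound passes to the lower limit.\<close>

lemma dir_deriv_nonneg_if_min:
  fixes X :: "'a::real_vector set"
  assumes "convex X" "y \<in> X" "y + d \<in> X" and min: "\<And>x. x \<in> X \<Longrightarrow> g y \<le> g x"
  shows "dir_deriv g y d \<ge> 0"
  unfolding dir_deriv_def
proof (rule Liminf_bounded)
  have "eventually (\<lambda>t::real. t \<in> {0<..<1}) (at_right 0)"
    by (rule eventually_at_right_real) simp
  then show "eventually (\<lambda>t. 0 \<le> ereal ((g (y + t *\<^sub>R d) - g y) / t)) (at_right 0)"
  proof eventually_elim
    case (elim t)
    have "(1 - t) *\<^sub>R y + t *\<^sub>R (y + d) \<in> X"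
      using assms elim by (intro convexD) auto
    then have "y + t *\<^sub>R d \<in> X"
      by (simp add: algebra_simps)
    then show ?case
      using min elim by simp
  qed
qed

lemma SUM_sequence_in:
  assumes "SUM_sequence u X s"
  shows "s n \<in> X"
  using assms by (cases n) (auto simp: SUM_sequence_def is_arg_min_def)

lemma SUM_sequence_le:
  fixes u :: "'a \<Rightarrow> 'a \<Rightarrow> real"
  assumes "SUM_sequence u X s" "x \<in> X"
  shows "u (s (Suc n)) (s n) \<le> u x (s n)"
proof -
  have "is_arg_min (\<lambda>x. u x (s n)) (\<lambda>x. x \<in> X) (s (Suc n))"
    using assms(1) unfolding SUM_sequence_def by (metis One_nat_def Suc_le_mono diff_Suc_1 le0)
  then show ?thesis
    using assms(2) by (auto simp: is_arg_min_linorder)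
qed

lemma SUM_limit_point_minimizes:
  fixes u :: "'a::topological_space \<Rightarrow> 'a \<Rightarrow> real"
  assumes "closed X" and f: "continuous_on X f"
    and A1: "\<forall>y\<in>X. u y y = f y"
    and A2: "\<forall>x\<in>X. \<forall>y\<in>X. u x y \<ge> f x"
    and A4: "continuous_on (X \<times> X) (\<lambda>(x, y). u x y)"
    and s: "SUM_sequence u X s"
    and z: "seq_limit_point s z"
  shows "z \<in> X" and "\<forall>x\<in>X. f z \<le> u x z"
proof -
  obtain r where r: "strict_mono r" and lim: "(\<lambda>k. s (r k)) \<longlonglongrightarrow> z"
    using z by (auto simp: seq_limit_point_def o_def)
  note in_X = SUM_sequence_in[OF s]
  show zX: "z \<in> X"
    using Lim_in_closed_set[OF \<open>closed X\<close> _ _ lim] in_X by simp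
  have step: "f (s (Suc n)) \<le> u x (s n)" if "x \<in> X" for n x
    using A2 in_X SUM_sequence_le[OF s that] by (meson order_trans)
  \<comment> \<open>Choose \<open>x = s n\<close> in \<open>step\<close>; \<open>A1\<close> turns
    the bound \<open>u (s n) (s n)\<close> into \<open>f (s n)\<close>.\<close>
  have dec: "decseq (\<lambda>n. f (s n))"
    using step in_X A1 by (metis decseq_SucI)
  show "\<forall>x\<in>X. f z \<le> u x z"
  proof
    fix x assume x: "x \<in> X"
    have "(\<lambda>k. f (s (r k))) \<longlonglongrightarrow> f z"
      using continuous_on_tendsto_compose[OF f lim zX] in_X by simp
    then have "(\<lambda>k. f (s (r (Suc k)))) \<longlonglongrightarrow> f z"
      by (rule LIMSEQ_Suc)
    \<comment> \<open>Joint continuity is applied along the pairs \<open>(x, s (r k))\<close>, with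
      the first coordinate fixed.\<close>
    moreover have "(\<lambda>k. u x (s (r k))) \<longlonglongrightarrow> u x z"
      using continuous_on_tendsto_compose[OF A4 tendsto_Pair[OF tendsto_const lim, of x]]
        x zX in_X by simp
    moreover have "f (s (r (Suc k))) \<le> u x (s (r k))" for k
    proof -
      \<comment> \<open>Minimality only relates consecutive iterates, while \<open>r\<close> may
        skip many. As \<open>r (Suc k)\<close> is at least \<open>Suc (r k)\<close>, monotonicity
        bridges the gap: \<open>f (s (r (Suc k)))\<close> is at most
        \<open>f (s (Suc (r k)))\<close>, which \<open>step\<close> bounds by
        \<open>u x (s (r k))\<close>.\<close>
      have "Suc (r k) \<le> r (Suc k)"
        using r by (simp add: Suc_leI strict_mono_Suc_iff)
      then show ?thesis
        using decseqD[OF dec] step[OF x] by (meson order_trans)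
    qed
    ultimately show "f z \<le> u x z"
      by (intro LIMSEQ_le) auto
  qed
qed

theorem theorem1:
  fixes X :: "(real ^ 'm) set"
    and f :: "real ^ 'm \<Rightarrow> real"
    and u :: "real ^ 'm \<Rightarrow> real ^ 'm \<Rightarrow> real"
    and s :: "nat \<Rightarrow> real ^ 'm"
  assumes "closed X" and "convex X"
    and "continuous_on X f"
    and A1: "\<forall>y\<in>X. u y y = f y"
    and A2: "\<forall>x\<in>X. \<forall>y\<in>X. u x y \<ge> f x"
    and A3: "\<forall>y\<in>X. \<forall>d. y + d \<in> X \<longrightarrow> dir_deriv (\<lambda>x. u x y) y d = dir_deriv f y d"
    and A4: "continuous_on (X \<times> X) (\<lambda>(x, y). u x y)"
    and "SUM_sequence u X s"
  shows "\<forall>z. seq_limit_point s z \<longrightarrow> stationary_point f X z"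
proof (intro allI impI)
  fix z assume z: "seq_limit_point s z"
  note min = SUM_limit_point_minimizes[OF \<open>closed X\<close> \<open>continuous_on X f\<close> A1 A2 A4
      \<open>SUM_sequence u X s\<close> z]
  show "stationary_point f X z"
    unfolding stationary_point_def
  proof (intro conjI allI impI)
    fix d assume d: "z + d \<in> X"
    \<comment> \<open>By \<open>A1\<close> at \<open>z\<close>, the bound \<open>f z\<close> \<le>
      \<open>u x z\<close> says that \<open>z\<close> minimizes \<open>u x z\<close> over
      \<open>x\<close> in \<open>X\<close>.\<close>
    have "dir_deriv (\<lambda>x. u x z) z d \<ge> 0"
      using dir_deriv_nonneg_if_min[OF \<open>convex X\<close> min(1) d] min A1 by simp
    then show "dir_deriv f z d \<ge> 0"
      using A3 min(1) d by simp
  qed (rule min(1))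
qed

end
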